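(* Suppose $\mathcal{A},\mathcal{B}\in\mathbb{C}^{I_1\times\cdots\times I_M\times I_1\times\cdots\times I_M}$ are Hermitian tensors with eigenvalues $\lambda_1\ge\lambda_2\ge\cdots\ge\lambda_{\mathbb{I}_1^M}$ and $\epsilon_1\ge\epsilon_2\ge\cdots\ge\epsilon_{\mathbb{I}_1^M}$, respectively. Let $\mathcal{C}=\mathcal{A}+\mathcal{B}$ with eigenvalues $\mu_1\ge\mu_2\ge\cdots\ge\mu_{\mathbb{I}_1^M}$. Then for every integer $1\le k\le\mathbb{I}_1^M$, $$\lambda_k+\epsilon_1\ \ge\ \mu_k\ \ge\ \lambda_k+\epsilon_{\mathbb{I}_1^M}.$$
   Context: $M$ and $I_1,\dots,I_M$ are positive integers and $\mathbb{I}_1^M=\prod_{j=1}^M I_j$. The Einstein product $\star_M$ sums over the last $M$ indices of the left factor against the first $M$ indices of the right factor: $(\mathcal{X}\star_M\mathcal{Y})_{i_1,\dots,i_M,k_1,\dots}=\sum_{j_1,\dots,j_M}\mathcal{X}_{i_1,\dots,i_M,j_1,\dots,j_M}\mathcal{Y}_{j_1,\dots,j_M,k_1,\dots}$. A tensor $\mathcal{A}$ is Hermitian if $\mathcal{A}_{i_1,\dots,i_M,j_1,\dots,j_M}=\overline{\mathcal{A}_{j_1,\dots,j_M,i_1,\dots,i_M}}$ for all indices. Eigenvalues of a Hermitian tensor $\mathcal{A}$ are taken with respect to the Einstein product ($\mathcal{A}\star_M\mathcal{V}=\lambda\mathcal{V}$ with $\mathcal{V}\in\mathbb{C}^{I_1\times\cdots\times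 I_M}$ nonzero), listed with multiplicity. *)

theory Defs
  imports Complex_Main "HOL-Library.Function_Algebras"
begin

text \<open>
  A complex tensor with dimension list \<open>ds\<close> is a function on multi-indices (lists of naturals)
  that vanishes outside the index box of \<open>ds\<close>, so that equality of tensors is equality of
  functions.  A tensor in \<open>\<complex>^(I\<^sub>1 \<times> \<dots> \<times> I\<^sub>M \<times> I\<^sub>1 \<times> \<dots> \<times> I\<^sub>M)\<close> has dimension list
  \<open>Is @ Is\<close>, and its entry at \<open>(i\<^sub>1,\<dots>,i\<^sub>M,j\<^sub>1,\<dots>,j\<^sub>M)\<close> is its value at \<open>i @ j\<close>.
  Sums of tensors are pointwise sums of functions.
\<close>

type_synonym ctensor = "nat list \<Rightarrow> complex"

definition multi_indices :: "nat list \<Rightarrow> nat list set" where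
  "multi_indices ds = listset (map (\<lambda>d. {1..d}) ds)"

definition tensors :: "nat list \<Rightarrow> ctensor set" where
  "tensors ds = {X. \<forall>i. i \<notin> multi_indices ds \<longrightarrow> X i = 0}"

definition tensor_scale :: "complex \<Rightarrow> ctensor \<Rightarrow> ctensor" where
  "tensor_scale c X = (\<lambda>i. c * X i)"

global_interpretation ctensor: vector_space tensor_scale
  by unfold_locales (auto simp: tensor_scale_def fun_eq_iff algebra_simps)

text \<open>
  The Einstein product of a tensor with dimension list \<open>P @ J\<close> and one with dimension list
  \<open>J @ Q\<close>, contracting the \<open>length J\<close> common indices; for the action on a tensor with
  dimension list \<open>J\<close>, the list \<open>Q\<close> is empty.
\<close>

definition einstein_prod ::
    "nat list \<Rightarrow> nat list \<Rightarrow> nat list \<Rightarrow> ctensor \<Rightarrow> ctensor \<Rightarrow> ctensor" where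
  "einstein_prod P J Q X Y =
     (\<lambda>l. if l \<in> multi_indices (P @ Q)
          then \<Sum>j\<in>multi_indices J. X (take (length P) l @ j) * Y (j @ drop (length P) l)
          else 0)"

definition hermitian_tensor :: "nat list \<Rightarrow> ctensor \<Rightarrow> bool" where
  "hermitian_tensor Is A \<longleftrightarrow>
     A \<in> tensors (Is @ Is) \<and>
     (\<forall>i\<in>multi_indices Is. \<forall>j\<in>multi_indices Is. A (i @ j) = cnj (A (j @ i)))"

definition tensor_eigenspace :: "nat list \<Rightarrow> ctensor \<Rightarrow> complex \<Rightarrow> ctensor set" where
  "tensor_eigenspace Is A z =
     {V \<in> tensors Is. einstein_prod Is Is [] A V = tensor_scale z V}"

definition tensor_eigenvalue :: "nat list \<Rightarrow> ctensor \<Rightarrow> complex \<Rightarrow> bool" where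
  "tensor_eigenvalue Is A z \<longleftrightarrow> (\<exists>V\<in>tensor_eigenspace Is A z. V \<noteq> 0)"

text \<open>
  \<open>lam 1 \<ge> \<dots> \<ge> lam N\<close>, with \<open>N\<close> the product of the dimensions, are the eigenvalues of \<open>A\<close>,
  each repeated as often as the dimension of its eigenspace.  For Hermitian tensors this is
  also the algebraic multiplicity.  Values of \<open>lam\<close> outside \<open>{1..N}\<close> are irrelevant.
\<close>

definition eigenvalues_decreasing :: "nat list \<Rightarrow> ctensor \<Rightarrow> (nat \<Rightarrow> real) \<Rightarrow> bool" where
  "eigenvalues_decreasing Is A lam \<longleftrightarrow>
     antimono_on {1..prod_list Is} lam \<and>
     (\<lambda>k. complex_of_real (lam k)) ` {1..prod_list Is} = {z. tensor_eigenvalue Is A z} \<and>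
     (\<forall>z. tensor_eigenvalue Is A z \<longrightarrow>
        card {k \<in> {1..prod_list Is}. complex_of_real (lam k) = z}
          = ctensor.dim (tensor_eigenspace Is A z))"

end

(* Courant-Fischer without orthonormal eigenvectors.  Eigenspaces of a Hermitian tensor are
   pairwise orthogonal, so the spectral data in the hypotheses force sums of eigenspaces to have
   the dimension counted by the eigenvalue list; in particular the whole space is such a sum.
   The eigenspaces of A for lam 1, ..., lam k and those of C for mu k, ..., mu N span subspaces
   whose dimensions add up to more than N, so they share a nonzero vector x.  Comparing the
   Rayleigh quotients of A, B and C at x gives mu k >= lam k + eps N; exchanging the two index
   ranges gives the other inequality. *)
theory Submission
  imports Defs
begin

section \<open>Linear algebra\<close>

text \<open>Induction adding one element \<open>c\<close> at a time: if \<open>c\<close> were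
  \<open>x + y\<close> with \<open>x\<close> in \<open>span B\<close> and \<open>y\<close> in
  \<open>span C\<close>, then \<open>x = c - y\<close> would lie in both spans, hence vanish,
  leaving \<open>c\<close> in \<open>span C\<close>.\<close>

lemma (in vector_space) independent_Un:
  assumes "finite C" "independent B" "independent C" "span B \<inter> span C \<subseteq> {0}"
  shows "independent (B \<union> C)"
  using assms(1,3,4)
proof (induction C rule: finite_induct)
  case empty
  then show ?case using assms(2) by simp
next
  case (insert c C)
  have indC: "independent C" and cC: "c \<notin> span C"
    using insert.prems(1) insert.hyps(2) by (auto simp: independent_insert)
  have sub: "span C \<subseteq> span (insert c C)" by (rule span_mono) auto
  have ind: "independent (B \<union> C)"
    using insert.IH indC insert.prems(2) sub by blast
  have "c \<notin> span (B \<union> C)"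
  proof
    assume "c \<in> span (B \<union> C)"
    then obtain x y where xy: "c = x + y" "x \<in> span B" "y \<in> span C"
      by (auto simp: span_Un)
    have "x = c - y" using xy by simp
    moreover have "c - y \<in> span (insert c C)"
      using xy sub by (meson insertI1 span_base span_diff subsetD)
    ultimately have "x = 0" using xy insert.prems(2) by auto
    then show False using xy cC by simp
  qed
  then show ?case using ind by (simp add: independent_insertI)
qed

text \<open>Dimension count: if the spans met only in 0, then \<open>B \<union> C\<close> would be a
  disjoint union and independent, with more elements than the spanning set \<open>D\<close>.\<close>

lemma (in vector_space) span_inter_nontrivial:
  assumes "finite B" "finite C" "independent B" "independent C"
    and "finite D" "B \<union> C \<subseteq> span D" "card D < card B + card C"
  shows "\<exists>x. x \<noteq> 0 \<and> x \<in> span B \<and> x \<in> span C"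
proof (rule ccontr)
  assume "\<not> ?thesis"
  then have triv: "span B \<inter> span C \<subseteq> {0}" by blast
  have "independent (B \<union> C)" by (rule independent_Un) (use assms triv in auto)
  then have "card (B \<union> C) \<le> card D"
    using independent_span_bound assms by blast
  moreover have "B \<inter> C = {}"
    using triv span_base[of _ B] span_base[of _ C] assms(3) dependent_zero by blast
  ultimately show False using card_Un_disjoint[of B C] assms by simp
qed

section \<open>Index boxes and the inner product\<close>

lemma set_Cons_eq_image: "set_Cons S T = (\<lambda>(x, xs). x # xs) ` (S \<times> T)"
  by (auto simp: set_Cons_def)

lemma finite_multi_indices: "finite (multi_indices ds)"
  by (induction ds) (auto simp: multi_indices_def set_Cons_eq_image)

lemma card_multi_indices: "card (multi_indices ds) = prod_list ds"
proof (induction ds)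
  case (Cons d ds)
  have "inj_on (\<lambda>(x, xs). x # xs) ({1..d} \<times> multi_indices ds)"
    by (auto simp: inj_on_def)
  then show ?case
    using Cons by (simp add: multi_indices_def set_Cons_eq_image card_image card_cartesian_product)
qed (simp add: multi_indices_def)

lemma length_multi_indices: "i \<in> multi_indices ds \<Longrightarrow> length i = length ds"
  by (induction ds arbitrary: i) (auto simp: multi_indices_def set_Cons_def)

text \<open>With \<open>Q\<close> empty every index \<open>l\<close> has length
  \<open>length Is\<close>, so \<open>take\<close> returns all of it and \<open>drop\<close> returns
  the empty list: the product is a matrix acting on a vector.\<close>

lemma einstein_prod_vector:
  "einstein_prod Is Is [] A X =
     (\<lambda>i. if i \<in> multi_indices Is then \<Sum>j\<in>multi_indices Is. A (i @ j) * X j else 0)"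
  by (auto simp: einstein_prod_def length_multi_indices fun_eq_iff)

text \<open>The standard inner product, conjugate-linear in the second argument. It sees only
  entries in the index box, so it is definite on \<open>tensors Is\<close> but not on all
  functions.\<close>

definition tinner :: "nat list \<Rightarrow> ctensor \<Rightarrow> ctensor \<Rightarrow> complex" where
  "tinner Is X Y = (\<Sum>i\<in>multi_indices Is. X i * cnj (Y i))"

lemma tinner_add_left: "tinner Is (X + Y) Z = tinner Is X Z + tinner Is Y Z"
  by (simp add: tinner_def algebra_simps sum.distrib)

lemma tinner_add_right: "tinner Is X (Y + Z) = tinner Is X Y + tinner Is X Z"
  by (simp add: tinner_def algebra_simps sum.distrib)

lemma tinner_zero [simp]: "tinner Is 0 Y = 0" "tinner Is X 0 = 0"
  by (simp_all add: tinner_def)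

lemma tinner_sum_left: "tinner Is (sum f R) Y = (\<Sum>r\<in>R. tinner Is (f r) Y)"
  using sum_comp_morphism[of "\<lambda>X. tinner Is X Y" f R]
  by (simp add: tinner_add_left o_def)

lemma tinner_sum_right: "tinner Is X (sum f R) = (\<Sum>r\<in>R. tinner Is X (f r))"
  using sum_comp_morphism[of "tinner Is X" f R] by (simp add: tinner_add_right o_def)

lemma tinner_scale_left: "tinner Is (tensor_scale c X) Y = c * tinner Is X Y"
  by (simp add: tinner_def tensor_scale_def sum_distrib_left mult.assoc)

lemma tinner_scale_right: "tinner Is X (tensor_scale c Y) = cnj c * tinner Is X Y"
  by (simp add: tinner_def tensor_scale_def sum_distrib_left algebra_simps)

lemma Re_tinner_self: "Re (tinner Is X X) = (\<Sum>i\<in>multi_indices Is. (cmod (X i))\<^sup>2)"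
  by (simp add: tinner_def cmod_power2 flip: power2_eq_square)

lemma Re_tinner_self_nonneg: "0 \<le> Re (tinner Is X X)"
  by (simp add: Re_tinner_self sum_nonneg)

lemma Re_tinner_self_eq_0:
  assumes "X \<in> tensors Is" "Re (tinner Is X X) = 0"
  shows "X = 0"
proof
  fix i
  show "X i = 0 i"
    using assms by (cases "i \<in> multi_indices Is")
      (auto simp: Re_tinner_self tensors_def sum_nonneg_eq_0_iff finite_multi_indices)
qed

text \<open>Self-adjointness: after the two sums are exchanged, the Hermitian symmetry turns
  \<open>A (i @ j)\<close> into the conjugated entry that the second argument of the inner product
  produces.\<close>

lemma tinner_hermitian:
  assumes "hermitian_tensor Is A"
  shows "tinner Is (einstein_prod Is Is [] A X) Y = tinner Is X (einstein_prod Is Is [] A Y)"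
proof -
  let ?I = "multi_indices Is"
  have "tinner Is (einstein_prod Is Is [] A X) Y =
      (\<Sum>i\<in>?I. \<Sum>j\<in>?I. A (i @ j) * X j * cnj (Y i))"
    by (simp add: tinner_def einstein_prod_vector sum_distrib_right)
  also have "\<dots> = (\<Sum>j\<in>?I. \<Sum>i\<in>?I. A (i @ j) * X j * cnj (Y i))"
    by (rule sum.swap)
  also have "\<dots> = (\<Sum>j\<in>?I. \<Sum>i\<in>?I. X j * (cnj (A (j @ i)) * cnj (Y i)))"
  proof (intro sum.cong refl)
    fix i j assume "i \<in> ?I" "j \<in> ?I"
    then have "A (i @ j) = cnj (A (j @ i))" using assms unfolding hermitian_tensor_def by blast
    then show "A (i @ j) * X j * cnj (Y i) = X j * (cnj (A (j @ i)) * cnj (Y i))"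
      by (simp only: mult_ac)
  qed
  also have "\<dots> = tinner Is X (einstein_prod Is Is [] A Y)"
    by (simp add: tinner_def einstein_prod_vector sum_distrib_left)
  finally show ?thesis .
qed

lemma hermitian_tensor_add:
  assumes "hermitian_tensor Is A" "hermitian_tensor Is B"
  shows "hermitian_tensor Is (A + B)"
  unfolding hermitian_tensor_def
proof (intro conjI ballI)
  show "A + B \<in> tensors (Is @ Is)"
    using assms by (simp add: hermitian_tensor_def tensors_def)
next
  fix i j assume "i \<in> multi_indices Is" "j \<in> multi_indices Is"
  then have "A (i @ j) = cnj (A (j @ i))" "B (i @ j) = cnj (B (j @ i))"
    using assms unfolding hermitian_tensor_def by blast+
  then show "(A + B) (i @ j) = cnj ((A + B) (j @ i))"
    by simp
qed

section \<open>Linearity of the Einstein product\<close>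

lemma einstein_prod_add_left:
  "einstein_prod P J Q (A + B) X = einstein_prod P J Q A X + einstein_prod P J Q B X"
  by (auto simp: einstein_prod_def fun_eq_iff algebra_simps sum.distrib)

lemma einstein_prod_add_right:
  "einstein_prod P J Q A (X + Y) = einstein_prod P J Q A X + einstein_prod P J Q A Y"
  by (auto simp: einstein_prod_def fun_eq_iff algebra_simps sum.distrib)

lemma einstein_prod_zero_right: "einstein_prod P J Q A 0 = 0"
  by (auto simp: einstein_prod_def fun_eq_iff)

lemma einstein_prod_scale_right:
  "einstein_prod P J Q A (tensor_scale c X) = tensor_scale c (einstein_prod P J Q A X)"
  by (auto simp: einstein_prod_def tensor_scale_def fun_eq_iff sum_distrib_left algebra_simps)

lemma einstein_prod_sum_right:
  "einstein_prod P J Q A (sum f R) = (\<Sum>r\<in>R. einstein_prod P J Q A (f r))"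
  using sum_comp_morphism[of "einstein_prod P J Q A" f R]
  by (simp add: einstein_prod_add_right einstein_prod_zero_right o_def)

section \<open>The space of tensors and a bound on its dimension\<close>

lemma subspace_tensors: "ctensor.subspace (tensors Is)"
  by (auto simp: ctensor.subspace_def tensors_def tensor_scale_def)

text \<open>The unit tensors \<open>e i\<close> span. The resulting upper bound on the dimension is
  what caps the size of independent sets in the later counting arguments.\<close>

lemma tensors_spanning_set:
  obtains D where "finite D" "card D \<le> prod_list Is" "tensors Is \<subseteq> ctensor.span D"
proof
  define e :: "nat list \<Rightarrow> ctensor" where "e i = (\<lambda>j. if j = i then 1 else 0)" for i
  let ?I = "multi_indices Is"
  show "finite (e ` ?I)" by (simp add: finite_multi_indices)
  show "card (e ` ?I) \<le> prod_list Is"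
    using card_image_le[OF finite_multi_indices] card_multi_indices by metis
  show "tensors Is \<subseteq> ctensor.span (e ` ?I)"
  proof
    fix X assume X: "X \<in> tensors Is"
    have apply_sum: "sum f S j = (\<Sum>i\<in>S. f i j)"
      for f :: "nat list \<Rightarrow> ctensor" and S j
      by (induction S rule: infinite_finite_induct) auto
    have "X = (\<Sum>i\<in>?I. tensor_scale (X i) (e i))"
    proof
      fix j
      have "(\<Sum>i\<in>?I. tensor_scale (X i) (e i)) j = (\<Sum>i\<in>?I. if j = i then X i else 0)"
        unfolding apply_sum by (intro sum.cong) (auto simp: tensor_scale_def e_def)
      also have "\<dots> = X j" using X by (auto simp: finite_multi_indices tensors_def)
      finally show "X j = (\<Sum>i\<in>?I. tensor_scale (X i) (e i)) j" by simp
    qed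
    moreover have "(\<Sum>i\<in>?I. tensor_scale (X i) (e i)) \<in> ctensor.span (e ` ?I)"
      by (intro ctensor.span_sum ctensor.span_scale ctensor.span_base) auto
    ultimately show "X \<in> ctensor.span (e ` ?I)" by simp
  qed
qed

section \<open>Sums of eigenspaces\<close>

text \<open>A real parameter allows eigenvalues to be ordered, and it is fixed by the conjugation in
  the second argument of \<open>tinner\<close>.\<close>

definition real_eigenspace :: "nat list \<Rightarrow> ctensor \<Rightarrow> real \<Rightarrow> ctensor set" where
  "real_eigenspace Is A r = tensor_eigenspace Is A (complex_of_real r)"

text \<open>Indexed by a set of values rather than by list positions, so a repeated eigenvalue
  contributes its whole eigenspace exactly once; the empty set gives the zero space.\<close>

definition eigen_span :: "nat list \<Rightarrow> ctensor \<Rightarrow> real set \<Rightarrow> ctensor set" where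
  "eigen_span Is A R = ctensor.span (\<Union>r\<in>R. real_eigenspace Is A r)"

lemma real_eigenspaceD:
  assumes "X \<in> real_eigenspace Is A r"
  shows "X \<in> tensors Is" "einstein_prod Is Is [] A X = tensor_scale (complex_of_real r) X"
  using assms by (auto simp: real_eigenspace_def tensor_eigenspace_def)

lemma subspace_real_eigenspace: "ctensor.subspace (real_eigenspace Is A r)"
  unfolding ctensor.subspace_def
proof (intro conjI ballI allI)
  show "0 \<in> real_eigenspace Is A r"
    by (simp add: real_eigenspace_def tensor_eigenspace_def einstein_prod_zero_right tensors_def)
next
  fix X Y assume "X \<in> real_eigenspace Is A r" "Y \<in> real_eigenspace Is A r"
  then show "X + Y \<in> real_eigenspace Is A r"
    using ctensor.subspace_add[OF subspace_tensors]
    by (simp add: real_eigenspace_def tensor_eigenspace_def einstein_prod_add_right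
        ctensor.scale_right_distrib)
next
  fix c X assume "X \<in> real_eigenspace Is A r"
  then show "tensor_scale c X \<in> real_eigenspace Is A r"
    using ctensor.subspace_scale[OF subspace_tensors]
    by (simp add: real_eigenspace_def tensor_eigenspace_def einstein_prod_scale_right mult.commute)
qed

lemma eigen_span_subset_tensors: "eigen_span Is A R \<subseteq> tensors Is"
  unfolding eigen_span_def
  by (rule ctensor.span_minimal) (auto dest: real_eigenspaceD simp: subspace_tensors)

text \<open>Moving \<open>A\<close> across the inner product gives \<open>r\<close> and
  \<open>s\<close> as factors of the same number, which must then be 0.\<close>

lemma real_eigenspaces_orthogonal:
  assumes "hermitian_tensor Is A" "X \<in> real_eigenspace Is A r" "Y \<in> real_eigenspace Is A s"
    and "r \<noteq> s"
  shows "tinner Is X Y = 0"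
proof -
  have "complex_of_real r * tinner Is X Y = complex_of_real s * tinner Is X Y"
    using tinner_hermitian[OF assms(1), of X Y] real_eigenspaceD(2)[OF assms(2)]
      real_eigenspaceD(2)[OF assms(3)]
    by (simp add: tinner_scale_left tinner_scale_right)
  then show ?thesis using assms(4) by simp
qed

lemma eigen_span_insert:
  "eigen_span Is A (insert r R) = {x + y | x y. x \<in> real_eigenspace Is A r \<and> y \<in> eigen_span Is A R}"
  by (simp add: eigen_span_def ctensor.span_Un subspace_real_eigenspace
      ctensor.span_eq_iff[THEN iffD2])

lemma eigen_span_decomposition:
  assumes "finite R" "X \<in> eigen_span Is A R"
  obtains f where "\<And>r. r \<in> R \<Longrightarrow> f r \<in> real_eigenspace Is A r" "X = sum f R"
proof -
  have "\<exists>f. (\<forall>r\<in>R. f r \<in> real_eigenspace Is A r) \<and> X = sum f R"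
    using assms
  proof (induction R arbitrary: X rule: finite_induct)
    case empty
    then show ?case by (simp add: eigen_span_def)
  next
    case (insert r R)
    then obtain x y where xy: "X = x + y" "x \<in> real_eigenspace Is A r" "y \<in> eigen_span Is A R"
      by (auto simp: eigen_span_insert)
    then obtain f where f: "\<forall>r\<in>R. f r \<in> real_eigenspace Is A r" "y = sum f R"
      using insert.IH by blast
    \<comment> \<open>As \<open>r\<close> lies outside \<open>R\<close>, the new component
      \<open>x\<close> can be stored at \<open>r\<close> without disturbing the old ones.\<close>
    have "sum (f(r := x)) R = sum f R" using insert.hyps by (intro sum.cong) auto
    then show ?case using xy f insert.hyps
      by (intro exI[of _ "f(r := x)"]) auto
  qed
  then show ?thesis using that by blast
qed

lemma eigen_span_orthogonal:
  assumes "hermitian_tensor Is A" "finite R" "r \<notin> R"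
    and "X \<in> real_eigenspace Is A r" "Y \<in> eigen_span Is A R"
  shows "tinner Is X Y = 0"
proof -
  obtain f where f: "\<And>s. s \<in> R \<Longrightarrow> f s \<in> real_eigenspace Is A s" "Y = sum f R"
    using eigen_span_decomposition assms by metis
  have "tinner Is X (f s) = 0" if "s \<in> R" for s
    using real_eigenspaces_orthogonal[OF assms(1,4) f(1)[OF that]] that assms(3) by auto
  then show ?thesis by (simp add: f(2) tinner_sum_right)
qed

text \<open>Dimensions add because the sum of eigenspaces is direct: each new eigenspace is
  orthogonal to the span of the earlier ones, so their bases are disjoint and jointly
  independent.\<close>

lemma eigen_span_basis:
  assumes "hermitian_tensor Is A" "finite R"
  obtains B where "finite B" "ctensor.independent B" "ctensor.span B = eigen_span Is A R"
    "card B = (\<Sum>r\<in>R. ctensor.dim (real_eigenspace Is A r))"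
proof -
  obtain D where D: "finite D" "tensors Is \<subseteq> ctensor.span D"
    using tensors_spanning_set by metis
  have "\<exists>B. finite B \<and> ctensor.independent B \<and> ctensor.span B = eigen_span Is A R \<and>
      card B = (\<Sum>r\<in>R. ctensor.dim (real_eigenspace Is A r))"
    using assms(2)
  proof (induction R rule: finite_induct)
    case empty
    then show ?case
      by (intro exI[of _ "{}"]) (simp add: eigen_span_def ctensor.independent_empty)
  next
    case (insert r R)
    let ?E = "real_eigenspace Is A r"
    obtain B where B: "finite B" "ctensor.independent B" "ctensor.span B = eigen_span Is A R"
      "card B = (\<Sum>r\<in>R. ctensor.dim (real_eigenspace Is A r))"
      using insert.IH by blast
    obtain B' where B': "B' \<subseteq> ?E" "ctensor.independent B'" "?E \<subseteq> ctensor.span B'"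
      "card B' = ctensor.dim ?E"
      using ctensor.basis_exists by blast
    have span': "ctensor.span B' = ?E"
      using B' ctensor.span_minimal[OF B'(1) subspace_real_eigenspace] by blast
    \<comment> \<open>Finiteness of \<open>B'\<close> comes from its being independent inside the
      span of the finite set \<open>D\<close>.\<close>
    have "B' \<subseteq> ctensor.span D"
      using B'(1) D(2) by (auto dest!: real_eigenspaceD(1))
    then have fin': "finite B'"
      using ctensor.independent_span_bound[OF D(1) B'(2)] by blast
    have triv: "ctensor.span B \<inter> ctensor.span B' \<subseteq> {0}"
    proof
      \<comment> \<open>Such an \<open>x\<close> lies in both of two orthogonal spaces, so it is
        orthogonal to itself.\<close>
      fix x assume x: "x \<in> ctensor.span B \<inter> ctensor.span B'"
      then have "tinner Is x x = 0"
        using eigen_span_orthogonal[OF assms(1) insert.hyps] B(3) span' by blast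
      moreover have "x \<in> tensors Is" using x span' real_eigenspaceD(1) by blast
      ultimately show "x \<in> {0}" using Re_tinner_self_eq_0 by simp
    qed
    have ind: "ctensor.independent (B \<union> B')"
      by (rule ctensor.independent_Un) (use B B' fin' triv in auto)
    have "B \<inter> B' = {}"
      using triv ctensor.span_base[of _ B] ctensor.span_base[of _ B'] B(2)
        ctensor.dependent_zero by blast
    then have "card (B \<union> B') = (\<Sum>r\<in>insert r R. ctensor.dim (real_eigenspace Is A r))"
      using B B' fin' insert.hyps by (simp add: card_Un_disjoint)
    moreover have "ctensor.span (B \<union> B') = eigen_span Is A (insert r R)"
      by (simp only: Un_commute[of B B'] eigen_span_insert ctensor.span_Un B(3) span')
    ultimately show ?case using ind B(1) fin' by blast
  qed
  then show ?thesis using that by blast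
qed

section \<open>Rayleigh quotients on sums of eigenspaces\<close>

text \<open>Orthogonality removes the cross terms. The free coefficient \<open>g\<close> serves two
  purposes: constant 1 gives the squared norm, and \<open>complex_of_real\<close> gives the
  quadratic form of \<open>A\<close>.\<close>

lemma tinner_eigen_sum:
  assumes "hermitian_tensor Is A" "finite R"
    and f: "\<And>r. r \<in> R \<Longrightarrow> f r \<in> real_eigenspace Is A r"
  shows "tinner Is (\<Sum>r\<in>R. tensor_scale (g r) (f r)) (sum f R)
    = (\<Sum>r\<in>R. g r * tinner Is (f r) (f r))"
proof -
  have "(\<Sum>s\<in>R. tinner Is (f r) (f s)) = tinner Is (f r) (f r)" if "r \<in> R" for r
  proof -
    have "(\<Sum>s\<in>R. tinner Is (f r) (f s)) = (\<Sum>s\<in>R. if r = s then tinner Is (f r) (f s) else 0)"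
      using real_eigenspaces_orthogonal[OF assms(1) f f] that by (intro sum.cong) auto
    then show ?thesis using that assms(2) by simp
  qed
  then show ?thesis
    unfolding tinner_sum_left tinner_scale_left by (simp add: tinner_sum_right)
qed

text \<open>The weight \<open>w r\<close> is the squared norm of the component of \<open>X\<close>
  in the eigenspace of \<open>r\<close>. For nonzero \<open>X\<close> the Rayleigh quotient is
  therefore a weighted mean of the values in \<open>R\<close>, bounded by any bounds on
  \<open>R\<close>.\<close>

lemma rayleigh_expansion:
  assumes "hermitian_tensor Is A" "finite R" "X \<in> eigen_span Is A R"
  obtains w where "\<And>r. r \<in> R \<Longrightarrow> 0 \<le> w r" "Re (tinner Is X X) = sum w R"
    "Re (tinner Is (einstein_prod Is Is [] A X) X) = (\<Sum>r\<in>R. r * w r)"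
proof -
  obtain f where f: "\<And>r. r \<in> R \<Longrightarrow> f r \<in> real_eigenspace Is A r" "X = sum f R"
    using eigen_span_decomposition assms by metis
  have AX: "einstein_prod Is Is [] A X = (\<Sum>r\<in>R. tensor_scale (complex_of_real r) (f r))"
    using real_eigenspaceD(2)[OF f(1)] by (simp add: f(2) einstein_prod_sum_right)
  show ?thesis
  proof
    show "0 \<le> Re (tinner Is (f r) (f r))" for r by (rule Re_tinner_self_nonneg)
    show "Re (tinner Is X X) = (\<Sum>r\<in>R. Re (tinner Is (f r) (f r)))"
      using tinner_eigen_sum[OF assms(1,2) f(1), where g = "\<lambda>_. 1"] by (simp add: f(2))
    show "Re (tinner Is (einstein_prod Is Is [] A X) X) =
        (\<Sum>r\<in>R. r * Re (tinner Is (f r) (f r)))"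
      using tinner_eigen_sum[OF assms(1,2) f(1), where g = complex_of_real] unfolding AX
      by (simp add: f(2))
  qed
qed

lemma rayleigh_lower:
  assumes "hermitian_tensor Is A" "finite R" "X \<in> eigen_span Is A R"
    and "\<And>r. r \<in> R \<Longrightarrow> c \<le> r"
  shows "c * Re (tinner Is X X) \<le> Re (tinner Is (einstein_prod Is Is [] A X) X)"
proof -
  obtain w where w: "\<And>r. r \<in> R \<Longrightarrow> 0 \<le> w r" "Re (tinner Is X X) = sum w R"
    "Re (tinner Is (einstein_prod Is Is [] A X) X) = (\<Sum>r\<in>R. r * w r)"
    using rayleigh_expansion[OF assms(1-3)] by metis
  show ?thesis unfolding w(2,3) sum_distrib_left
    by (intro sum_mono mult_right_mono) (use w assms in auto)
qed

lemma rayleigh_upper: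
  assumes "hermitian_tensor Is A" "finite R" "X \<in> eigen_span Is A R"
    and "\<And>r. r \<in> R \<Longrightarrow> r \<le> c"
  shows "Re (tinner Is (einstein_prod Is Is [] A X) X) \<le> c * Re (tinner Is X X)"
proof -
  obtain w where w: "\<And>r. r \<in> R \<Longrightarrow> 0 \<le> w r" "Re (tinner Is X X) = sum w R"
    "Re (tinner Is (einstein_prod Is Is [] A X) X) = (\<Sum>r\<in>R. r * w r)"
    using rayleigh_expansion[OF assms(1-3)] by metis
  show ?thesis unfolding w(2,3) sum_distrib_left
    by (intro sum_mono mult_right_mono) (use w assms in auto)
qed

section \<open>Eigenvalue lists\<close>

text \<open>\<open>J\<close> is split into the fibres of \<open>lam\<close>. The fibre of
  \<open>r\<close> over all positions has as many elements as the eigenspace has dimensions;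
  \<open>J\<close> may contain only some of the copies of a repeated eigenvalue, hence an
  inequality.\<close>

lemma eigen_list_basis:
  assumes "hermitian_tensor Is A" "eigenvalues_decreasing Is A lam" "J \<subseteq> {1..prod_list Is}"
  obtains B where "finite B" "ctensor.independent B" "ctensor.span B = eigen_span Is A (lam ` J)"
    "card J \<le> card B"
proof -
  let ?N = "{1..prod_list Is}"
  have finJ: "finite J" using assms(3) finite_subset by blast
  obtain B where B: "finite B" "ctensor.independent B" "ctensor.span B = eigen_span Is A (lam ` J)"
    "card B = (\<Sum>r\<in>lam ` J. ctensor.dim (real_eigenspace Is A r))"
    using eigen_span_basis[OF assms(1), of "lam ` J"] finJ by blast
  have dim: "ctensor.dim (real_eigenspace Is A r) = card {j \<in> ?N. lam j = r}" if "r \<in> lam ` J" for r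
  proof -
    \<comment> \<open>The multiplicity clause speaks only of actual eigenvalues, so \<open>r\<close>
      must first be recognised as one.\<close>
    have "complex_of_real r \<in> {z. tensor_eigenvalue Is A z}"
      using assms(2,3) that unfolding eigenvalues_decreasing_def by blast
    then have "card {j \<in> ?N. complex_of_real (lam j) = complex_of_real r} =
        ctensor.dim (real_eigenspace Is A r)"
      using assms(2) unfolding eigenvalues_decreasing_def real_eigenspace_def by blast
    then show ?thesis by simp
  qed
  have "card J = card (\<Union>r\<in>lam ` J. {j \<in> J. lam j = r})"
    by (rule arg_cong[of _ _ card]) auto
  also have "\<dots> \<le> (\<Sum>r\<in>lam ` J. card {j \<in> J. lam j = r})"
    by (rule card_UN_le) (use finJ in auto)
  also have "\<dots> \<le> (\<Sum>r\<in>lam ` J. card {j \<in> ?N. lam j = r})"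
    by (intro sum_mono card_mono) (use assms(3) in auto)
  also have "\<dots> = card B" using B(4) dim by simp
  finally show ?thesis using that B by blast
qed

text \<open>This plays the part of the spectral theorem: the full list yields at least
  \<open>prod_list Is\<close> independent vectors, which already exhaust the dimension of the
  space.\<close>

lemma eigen_span_all:
  assumes "hermitian_tensor Is A" "eigenvalues_decreasing Is A lam"
  shows "eigen_span Is A (lam ` {1..prod_list Is}) = tensors Is"
proof
  obtain D where D: "finite D" "card D \<le> prod_list Is" "tensors Is \<subseteq> ctensor.span D"
    using tensors_spanning_set by metis
  obtain B where B: "finite B" "ctensor.independent B"
    "ctensor.span B = eigen_span Is A (lam ` {1..prod_list Is})" "prod_list Is \<le> card B"
    using eigen_list_basis[OF assms subset_refl] by auto
  show "tensors Is \<subseteq> eigen_span Is A (lam ` {1..prod_list Is})"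
  proof
    fix X assume X: "X \<in> tensors Is"
    show "X \<in> eigen_span Is A (lam ` {1..prod_list Is})"
    proof (rule ccontr)
      \<comment> \<open>A tensor outside the span would enlarge \<open>B\<close> to an independent
        set with more elements than \<open>D\<close>.\<close>
      assume "\<not> ?thesis"
      then have nin: "X \<notin> ctensor.span B" using B(3) by simp
      then have "ctensor.independent (insert X B)"
        using B(2) ctensor.independent_insertI by blast
      moreover have "insert X B \<subseteq> ctensor.span D"
        using X D(3) B(3) eigen_span_subset_tensors ctensor.span_superset[of B] by blast
      ultimately have "card (insert X B) \<le> card D"
        using ctensor.independent_span_bound[OF D(1)] by blast
      moreover have "X \<notin> B" using nin ctensor.span_base by blast
      ultimately show False using B D by simp
    qed
  qed
qed (rule eigen_span_subset_tensors)

text \<open>The two subspaces have dimensions at least \<open>card J\<close> and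
  \<open>card K\<close>, too much for them to meet only in 0. The common vector has positive squared
  norm, by which Rayleigh estimates can later be divided.\<close>

lemma eigen_spans_meet:
  assumes "hermitian_tensor Is A" "eigenvalues_decreasing Is A lam" "J \<subseteq> {1..prod_list Is}"
    and "hermitian_tensor Is C" "eigenvalues_decreasing Is C mu" "K \<subseteq> {1..prod_list Is}"
    and "prod_list Is < card J + card K"
  obtains X where "X \<in> eigen_span Is A (lam ` J)" "X \<in> eigen_span Is C (mu ` K)"
    "0 < Re (tinner Is X X)"
proof -
  obtain D where D: "finite D" "card D \<le> prod_list Is" "tensors Is \<subseteq> ctensor.span D"
    using tensors_spanning_set by metis
  obtain B where B: "finite B" "ctensor.independent B"
    "ctensor.span B = eigen_span Is A (lam ` J)" "card J \<le> card B"
    using eigen_list_basis[OF assms(1-3)] .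
  obtain B' where B': "finite B'" "ctensor.independent B'"
    "ctensor.span B' = eigen_span Is C (mu ` K)" "card K \<le> card B'"
    using eigen_list_basis[OF assms(4-6)] .
  have "B \<union> B' \<subseteq> tensors Is"
    using B(3) B'(3) ctensor.span_superset[of B] ctensor.span_superset[of B']
      eigen_span_subset_tensors by blast
  then obtain X where X: "X \<noteq> 0" "X \<in> ctensor.span B" "X \<in> ctensor.span B'"
    using ctensor.span_inter_nontrivial[OF B(1) B'(1) B(2) B'(2) D(1)] D B(4) B'(4) assms(7)
    by force
  then have "X \<in> tensors Is" using B(3) eigen_span_subset_tensors by blast
  then have "Re (tinner Is X X) \<noteq> 0" using Re_tinner_self_eq_0 X(1) by blast
  then have "0 < Re (tinner Is X X)" using Re_tinner_self_nonneg[of Is X] by linarith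
  then show ?thesis using that X B(3) B'(3) by blast
qed

lemma eigenvalues_decreasingD:
  assumes "eigenvalues_decreasing Is A lam" "1 \<le> i" "i \<le> j" "j \<le> prod_list Is"
  shows "lam j \<le> lam i"
  using assms unfolding eigenvalues_decreasing_def monotone_on_def by auto

section \<open>Weyl's inequalities\<close>

theorem theorem2:
  fixes M :: nat and Is :: "nat list"
    and A B C :: ctensor
    and lam eps mu :: "nat \<Rightarrow> real"
    and k :: nat
  assumes "M \<ge> 1" and "length Is = M" and "\<forall>d\<in>set Is. d \<ge> 1"
    and "hermitian_tensor Is A" and "hermitian_tensor Is B"
    and "C = A + B"
    and "eigenvalues_decreasing Is A lam"
    and "eigenvalues_decreasing Is B eps"
    and "eigenvalues_decreasing Is C mu"
    and "1 \<le> k" and "k \<le> prod_list Is"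
  shows "lam k + eps 1 \<ge> mu k \<and> mu k \<ge> lam k + eps (prod_list Is)"
proof
  let ?N = "prod_list Is"
  let ?q = "\<lambda>T X. Re (tinner Is (einstein_prod Is Is [] T X) X)"
  have hC: "hermitian_tensor Is C" using assms(4-6) hermitian_tensor_add by simp
  have qC: "?q C X = ?q A X + ?q B X" for X
    using assms(6) by (simp add: einstein_prod_add_left tinner_add_left)
  \<comment> \<open>The eigenspaces of \<open>B\<close> span all tensors, so the extreme eigenvalues
    \<open>eps 1\<close> and \<open>eps ?N\<close> bound its Rayleigh quotient at whichever vector
    is chosen for \<open>A\<close> and \<open>C\<close>.\<close>
  have inB: "X \<in> eigen_span Is B (eps ` {1..?N})" if "X \<in> eigen_span Is A R" for X R
    using that eigen_span_subset_tensors eigen_span_all[OF assms(5,8)] by blast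
  note dec = eigenvalues_decreasingD
  have low: "{1..k} \<subseteq> {1..?N}" and high: "{k..?N} \<subseteq> {1..?N}"
    using assms(10,11) by auto
  show "mu k \<le> lam k + eps 1"
  proof -
    obtain X where X: "X \<in> eigen_span Is A (lam ` {k..?N})" "X \<in> eigen_span Is C (mu ` {1..k})"
      "0 < Re (tinner Is X X)"
      using eigen_spans_meet[OF assms(4,7) high hC assms(9) low] assms(11) by auto
    have "mu k * Re (tinner Is X X) \<le> ?q C X"
      by (rule rayleigh_lower[OF hC _ X(2)]) (use assms dec[OF assms(9)] in auto)
    moreover have "?q A X \<le> lam k * Re (tinner Is X X)"
      by (rule rayleigh_upper[OF assms(4) _ X(1)]) (use assms dec[OF assms(7)] in auto)
    moreover have "?q B X \<le> eps 1 * Re (tinner Is X X)"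
      by (rule rayleigh_upper[OF assms(5) _ inB[OF X(1)]]) (use assms dec[OF assms(8)] in auto)
    ultimately have "mu k * Re (tinner Is X X) \<le> (lam k + eps 1) * Re (tinner Is X X)"
      by (simp add: qC distrib_right)
    then show ?thesis using X(3) by simp
  qed
  show "lam k + eps ?N \<le> mu k"
  proof -
    obtain X where X: "X \<in> eigen_span Is A (lam ` {1..k})" "X \<in> eigen_span Is C (mu ` {k..?N})"
      "0 < Re (tinner Is X X)"
      using eigen_spans_meet[OF assms(4,7) low hC assms(9) high] assms(11) by auto
    have "?q C X \<le> mu k * Re (tinner Is X X)"
      by (rule rayleigh_upper[OF hC _ X(2)]) (use assms dec[OF assms(9)] in auto)
    moreover have "lam k * Re (tinner Is X X) \<le> ?q A X"
      by (rule rayleigh_lower[OF assms(4) _ X(1)]) (use assms dec[OF assms(7)] in auto)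
    moreover have "eps ?N * Re (tinner Is X X) \<le> ?q B X"
      by (rule rayleigh_lower[OF assms(5) _ inB[OF X(1)]]) (use assms dec[OF assms(8)] in auto)
    ultimately have "(lam k + eps ?N) * Re (tinner Is X X) \<le> mu k * Re (tinner Is X X)"
      by (simp add: qC distrib_right)
    then show ?thesis using X(3) by simp
  qed
qed

end
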